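(* Let $\lambda>0$ and consider the function $F:\mathbb{S}^m\to\mathbb{R}\cup\{+\infty\}$ given by $F(\Sigma)=-\log\det(\Sigma)+\tfrac{\lambda}{2}\mathrm{tr}(\Sigma^2)$ for $\Sigma\in\mathbb{S}^m_+$ and $F(\Sigma)=+\infty$ otherwise. Then $F\in\mathcal{E}^m$, $F$ is essentially smooth, and $\nabla F(\Sigma)=\lambda\Sigma-\Sigma^{-1}$ maps $\mathbb{S}^m_+$ bijectively to $\mathbb{S}^m$.
   Context: $\mathbb{S}^m$ is the space of real symmetric $m\times m$ matrices with inner product $\langle A,B\rangle=\mathrm{tr}(AB)$ and Frobenius norm $\|\cdot\|_F$; $\mathbb{S}^m_+$ and $\overline{\mathbb{S}}^m_+$ are the subsets of positive definite and positive semidefinite matrices. $\mathcal{E}^m$ is the set of functions $F:\mathbb{S}^m\to\mathbb{R}\cup\{+\infty\}$ such that (i) $F$ is convex, not identically $+\infty$, and lower semicontinuous; (ii) $\mathbb{S}^m_+\subseteq\mathrm{dom}(F)\subseteq\overline{\mathbb{S}}^m_+$, where $\mathrm{dom}(F)=\{F<+\infty\}$; (iii) $F$ is strictly convex and continuously differentiable on $\mathbb{S}^m_+$. Gradients are with respect to $\langle\cdot,\cdot\rangle$. $F$ is essentially smooth if it is differentiable on $\mathrm{int}(\mathrm{dom}(F))$ and $\|\nabla F(\Sigma_k)\|_F\to\infty$ for every sequence $(\Sigma_k)$ in $\mathrm{int}(\mathrm{dom}(F))$ converging to a boundary point of $\mathrm{dom}(F)$. *)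

theory Defs
  imports "HOL-Analysis.Analysis"
begin

text \<open>
  Symmetric matrices form a linear subspace of \<open>real ^ 'm ^ 'm\<close>. A function
  \<open>\<S>\<^sup>m \<rightarrow> \<real> \<union> {+\<infinity>}\<close> is modelled by a function \<open>F :: real ^ 'm ^ 'm \<Rightarrow> ereal\<close> of which
  only the values on \<open>sym_mats\<close> matter: all definitions below are relative to that subspace.
\<close>

definition sym_mats :: "(real ^ 'm ^ 'm) set" where
  "sym_mats = {A. transpose A = A}"

definition pd_mats :: "(real ^ 'm ^ 'm) set" where
  "pd_mats = {A \<in> sym_mats. \<forall>x. x \<noteq> 0 \<longrightarrow> 0 < x \<bullet> (A *v x)}"

definition psd_mats :: "(real ^ 'm ^ 'm) set" where
  "psd_mats = {A \<in> sym_mats. \<forall>x. 0 \<le> x \<bullet> (A *v x)}"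

text \<open>
  The ambient inner product and norm restrict to the trace inner product and the Frobenius norm.
\<close>

lemma inner_sym_mats:
  fixes A B :: "real ^ 'm ^ 'm"
  assumes "A \<in> sym_mats"
  shows "A \<bullet> B = trace (A ** B)"
proof -
  have "A $ i $ j = A $ j $ i" for i j
    using assms by (auto simp: sym_mats_def transpose_def vec_eq_iff)
  then have "A \<bullet> B = (\<Sum>i\<in>UNIV. \<Sum>j\<in>UNIV. A $ j $ i * B $ i $ j)"
    by (simp add: inner_vec_def)
  also have "\<dots> = (\<Sum>j\<in>UNIV. \<Sum>i\<in>UNIV. A $ j $ i * B $ i $ j)"
    by (rule sum.swap)
  finally show ?thesis
    by (simp add: trace_def matrix_matrix_mult_def)
qed

lemma norm_sym_mats:
  fixes A :: "real ^ 'm ^ 'm"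
  assumes "A \<in> sym_mats"
  shows "norm A = sqrt (trace (A ** A))"
  by (simp add: norm_eq_sqrt_inner inner_sym_mats[OF assms])

definition edom :: "(real ^ 'm ^ 'm \<Rightarrow> ereal) \<Rightarrow> (real ^ 'm ^ 'm) set" where
  "edom F = {X \<in> sym_mats. F X < \<infinity>}"

text \<open>
  Interior and boundary are taken in the space of symmetric matrices; in the ambient space
  every set of symmetric matrices has empty interior as soon as \<open>CARD('m) \<ge> 2\<close>.
\<close>

definition sym_interior :: "(real ^ 'm ^ 'm) set \<Rightarrow> (real ^ 'm ^ 'm) set" where
  "sym_interior S = top_of_set sym_mats interior_of S"

definition sym_frontier :: "(real ^ 'm ^ 'm) set \<Rightarrow> (real ^ 'm ^ 'm) set" where
  "sym_frontier S = top_of_set sym_mats frontier_of S"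

text \<open>
  \<open>G\<close> is the gradient of \<open>F\<close> at \<open>X\<close> for the trace inner product. Differentiability presupposes
  that \<open>F\<close> is finite near \<open>X\<close>; the conversion \<open>real_of_ereal\<close> sends infinite values to \<open>0\<close>,
  hence the first conjunct.
\<close>

definition has_sym_gradient ::
  "(real ^ 'm ^ 'm \<Rightarrow> ereal) \<Rightarrow> real ^ 'm ^ 'm \<Rightarrow> real ^ 'm ^ 'm \<Rightarrow> bool" where
  "has_sym_gradient F G X \<longleftrightarrow>
     X \<in> sym_interior (edom F) \<and> G \<in> sym_mats \<and>
     ((\<lambda>Y. real_of_ereal (F Y)) has_derivative (\<lambda>H. trace (G ** H))) (at X within sym_mats)"

definition sym_differentiable :: "(real ^ 'm ^ 'm \<Rightarrow> ereal) \<Rightarrow> real ^ 'm ^ 'm \<Rightarrow> bool" where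
  "sym_differentiable F X \<longleftrightarrow> (\<exists>G. has_sym_gradient F G X)"

definition sym_gradient :: "(real ^ 'm ^ 'm \<Rightarrow> ereal) \<Rightarrow> real ^ 'm ^ 'm \<Rightarrow> real ^ 'm ^ 'm" where
  "sym_gradient F X = (THE G. has_sym_gradient F G X)"

lemma has_sym_gradient_unique:
  assumes "has_sym_gradient F G X" and "has_sym_gradient F G' X"
  shows "G = G'"
proof -
  define H where "H = G - G'"
  have G: "G \<in> sym_mats" "G' \<in> sym_mats"
    using assms by (auto simp: has_sym_gradient_def)
  have X: "X \<in> sym_mats"
    using assms(1) interior_of_subset_topspace[of "top_of_set sym_mats" "edom F"]
    by (auto simp: has_sym_gradient_def sym_interior_def)
  have H: "H \<in> sym_mats" and line: "X + t *\<^sub>R H \<in> sym_mats" for t :: real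
    using G X by (auto simp: H_def sym_mats_def transpose_def vec_eq_iff)
  have along: "((\<lambda>t::real. real_of_ereal (F (X + t *\<^sub>R H))) has_derivative
      (\<lambda>t. trace (K ** (t *\<^sub>R H)))) (at 0)"
    if K: "has_sym_gradient F K X" for K
  proof -
    have F': "((\<lambda>Y. real_of_ereal (F Y)) has_derivative (\<lambda>H. trace (K ** H)))
        (at X within sym_mats)"
      using K by (simp add: has_sym_gradient_def)
    have "((\<lambda>Y. real_of_ereal (F Y)) has_derivative (\<lambda>H. trace (K ** H)))
        (at (X + 0 *\<^sub>R H) within range (\<lambda>t::real. X + t *\<^sub>R H))"
      using has_derivative_subset[OF F'] line by (simp add: image_subset_iff)
    moreover have "((\<lambda>t::real. X + t *\<^sub>R H) has_derivative (\<lambda>t. t *\<^sub>R H)) (at 0)"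
      by (auto intro!: derivative_eq_intros)
    ultimately show ?thesis
      using has_derivative_in_compose[of "\<lambda>t::real. X + t *\<^sub>R H" "\<lambda>t. t *\<^sub>R H" 0 UNIV
          "\<lambda>Y. real_of_ereal (F Y)" "\<lambda>H. trace (K ** H)"] by simp
  qed
  have "trace (G ** (1 *\<^sub>R H)) = trace (G' ** (1 *\<^sub>R H))"
    using has_derivative_unique[OF along[OF assms(1)] along[OF assms(2)]] by (rule fun_cong)
  then have "H \<bullet> H = 0"
    using G by (simp add: H_def inner_sym_mats[symmetric] inner_diff_left)
  then show ?thesis
    by (simp add: H_def)
qed

lemma sym_gradient_eq: "has_sym_gradient F G X \<Longrightarrow> sym_gradient F X = G"
  unfolding sym_gradient_def by (blast intro: the_equality has_sym_gradient_unique)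

text \<open>
  Restricting the convexity inequality to \<open>0 < t < 1\<close> avoids \<open>0 * \<infinity>\<close>; the excluded cases are
  trivial. The punctured lower limit in the semicontinuity clause is equivalent to the full one.
\<close>

definition sym_convex :: "(real ^ 'm ^ 'm \<Rightarrow> ereal) \<Rightarrow> bool" where
  "sym_convex F \<longleftrightarrow> (\<forall>X\<in>sym_mats. \<forall>Y\<in>sym_mats. \<forall>t::real. 0 < t \<and> t < 1 \<longrightarrow>
     F (t *\<^sub>R X + (1 - t) *\<^sub>R Y) \<le> ereal t * F X + ereal (1 - t) * F Y)"

definition strictly_convex_on :: "(real ^ 'm ^ 'm) set \<Rightarrow> (real ^ 'm ^ 'm \<Rightarrow> ereal) \<Rightarrow> bool" where
  "strictly_convex_on S F \<longleftrightarrow> (\<forall>X\<in>S. \<forall>Y\<in>S. \<forall>t::real. X \<noteq> Y \<and> 0 < t \<and> t < 1 \<longrightarrow>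
     F (t *\<^sub>R X + (1 - t) *\<^sub>R Y) < ereal t * F X + ereal (1 - t) * F Y)"

definition sym_lsc :: "(real ^ 'm ^ 'm \<Rightarrow> ereal) \<Rightarrow> bool" where
  "sym_lsc F \<longleftrightarrow> (\<forall>X\<in>sym_mats. F X \<le> Liminf (at X within sym_mats) F)"

definition class_E :: "(real ^ 'm ^ 'm \<Rightarrow> ereal) set" where
  "class_E = {F.
     (\<forall>X\<in>sym_mats. F X \<noteq> -\<infinity>) \<and>
     sym_convex F \<and> (\<exists>X\<in>sym_mats. F X \<noteq> \<infinity>) \<and> sym_lsc F \<and>
     pd_mats \<subseteq> edom F \<and> edom F \<subseteq> psd_mats \<and>
     strictly_convex_on pd_mats F \<and>
     (\<forall>X\<in>pd_mats. sym_differentiable F X) \<and> continuous_on pd_mats (sym_gradient F)}"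

definition essentially_smooth :: "(real ^ 'm ^ 'm \<Rightarrow> ereal) \<Rightarrow> bool" where
  "essentially_smooth F \<longleftrightarrow>
     (\<forall>X\<in>sym_interior (edom F). sym_differentiable F X) \<and>
     (\<forall>\<Sigma> :: nat \<Rightarrow> real ^ 'm ^ 'm. \<forall>S\<in>sym_frontier (edom F).
        (\<forall>k. \<Sigma> k \<in> sym_interior (edom F)) \<and> \<Sigma> \<longlonglongrightarrow> S \<longrightarrow>
        filterlim (\<lambda>k. norm (sym_gradient F (\<Sigma> k))) at_top sequentially)"

end

theory Submission
  imports Defs
begin

text \<open>
  Everything rests on one inequality. If \<open>N\<close> is positive definite with eigenvalues \<open>d i\<close>, then
  summing \<open>ln (d i) \<le> d i - 1\<close> gives \<open>ln (det N) \<le> trace N - CARD('m)\<close>. Applied to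
  \<open>N = Z\<^bsup>-1/2\<^esup> X Z\<^bsup>-1/2\<^esup>\<close> it says that the log-determinant lies below its tangent planes:
  \<open>ln (det X) - ln (det Z) \<le> matrix_inv Z \<bullet> (X - Z)\<close> (lemma \<open>ln_det_le_tangent\<close>).

  Averaging this inequality gives concavity of the log-determinant, and the quadratic term makes
  \<open>F\<close> strictly convex. Using it for \<open>(X, Z)\<close> and \<open>(Z, X)\<close> together bounds the linearisation error
  of the log-determinant, so its gradient is the inverse (\<open>ln_det_has_derivative\<close>), and shows
  that inversion is antimonotone, so \<open>S \<mapsto> lam S - matrix_inv S\<close> is injective. Surjectivity is
  the solution of a quadratic equation for each eigenvalue (\<open>reg_gradient_bij\<close>).

  A boundary point \<open>S\<close> of the cone is positive semidefinite and has a kernel vector. Hence its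
  determinant vanishes, which yields lower semicontinuity, and the inverses of positive definite
  matrices tending to \<open>S\<close> are unbounded, which yields essential smoothness
  (\<open>norm_matrix_inv_at_top\<close>).

  The spectral theorem needed for eigenvalues and square roots is derived first, by maximising
  the quadratic form on invariant subspaces.
\<close>

section \<open>The spectral theorem for symmetric matrices\<close>

lemma inner_mult_sym_mats:
  fixes A :: "real ^ 'm ^ 'm"
  assumes "A \<in> sym_mats"
  shows "x \<bullet> (A *v y) = (A *v x) \<bullet> y"
  using assms by (metis (mono_tags) dot_lmul_matrix mem_Collect_eq sym_mats_def
      vector_transpose_matrix)

text \<open>
  On an invariant subspace, a maximiser \<open>v\<close> of the quadratic form over the unit sphere is an
  eigenvector: with \<open>\<mu>\<close> the maximum, \<open>y \<mapsto> \<mu> (y \<bullet> y) - y \<bullet> A y\<close> is nonnegative on the subspace and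
  vanishes at \<open>v\<close>, so its derivative at \<open>v\<close> in the direction \<open>A v - \<mu> v\<close> is zero.
\<close>

lemma sym_mats_eigenvector:
  fixes A :: "real ^ 'm ^ 'm"
  assumes A: "A \<in> sym_mats" and V: "subspace V" "V \<noteq> {0}"
    and inv: "\<And>v. v \<in> V \<Longrightarrow> A *v v \<in> V"
  obtains v \<mu> where "v \<in> V" "norm v = 1" "A *v v = \<mu> *\<^sub>R v"
proof -
  let ?K = "sphere 0 1 \<inter> V"
  have "compact ?K"
    by (intro compact_Int_closed compact_sphere closed_subspace V)
  moreover have "?K \<noteq> {}"
  proof -
    obtain w where "w \<in> V" "w \<noteq> 0"
      using V subspace_0 by blast
    then have "(1 / norm w) *\<^sub>R w \<in> ?K"
      using V by (simp add: subspace_scale)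
    then show ?thesis by blast
  qed
  moreover have "continuous_on ?K (\<lambda>x. x \<bullet> (A *v x))"
    by (intro continuous_intros)
  ultimately obtain v where v: "v \<in> ?K" and max: "\<And>x. x \<in> ?K \<Longrightarrow> x \<bullet> (A *v x) \<le> v \<bullet> (A *v v)"
    using continuous_attains_sup[of ?K "\<lambda>x. x \<bullet> (A *v x)"] by blast
  define \<mu> where "\<mu> = v \<bullet> (A *v v)"
  define w where "w = A *v v - \<mu> *\<^sub>R v"
  have vv: "v \<bullet> v = 1" "norm v = 1" "v \<in> V"
    using v by (auto simp: norm_eq_1)
  have wV: "w \<in> V"
    unfolding w_def using V vv inv by (intro subspace_diff subspace_scale) auto
  have form: "y \<bullet> (A *v y) \<le> \<mu> * (y \<bullet> y)" if "y \<in> V" for y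
  proof (cases "y = 0")
    case False
    have "(1 / norm y) *\<^sub>R y \<in> ?K"
      using that False V by (simp add: subspace_scale)
    from max[OF this] have "(1 / norm y)\<^sup>2 * (y \<bullet> (A *v y)) \<le> \<mu>"
      by (simp add: \<mu>_def matrix_vector_mult_scaleR power2_eq_square)
    then show ?thesis
      using False by (simp add: field_simps power2_norm_eq_inner)
  qed simp
  have Aw: "w \<bullet> (A *v v) = v \<bullet> (A *v w)"
    using inner_mult_sym_mats[OF A] by (simp add: inner_commute)
  have vw: "v \<bullet> w = 0"
    using vv by (simp add: w_def inner_diff_right \<mu>_def)
  then have ww: "w \<bullet> (A *v v) = w \<bullet> w"
    by (subst (2) w_def) (simp add: inner_diff_right inner_commute[of w v])
  have *: "2 * t * (w \<bullet> w) \<le> t\<^sup>2 * (\<mu> * (w \<bullet> w) - w \<bullet> (A *v w))" for t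
  proof -
    have "(v + t *\<^sub>R w) \<bullet> (A *v (v + t *\<^sub>R w)) \<le> \<mu> * ((v + t *\<^sub>R w) \<bullet> (v + t *\<^sub>R w))"
      using form V vv wV by (simp add: subspace_add subspace_scale)
    then show ?thesis
      using Aw vv vw ww
      by (simp add: matrix_vector_mult_scaleR matrix_vector_right_distrib inner_add_left
          inner_add_right inner_commute[of w v] \<mu>_def[symmetric] algebra_simps power2_eq_square)
  qed
  define c where "c = \<mu> * (w \<bullet> w) - w \<bullet> (A *v w)"
  have "w \<bullet> w \<le> 0"
  proof (rule ccontr)
    assume pos: "\<not> w \<bullet> w \<le> 0"
    have "2 * (w \<bullet> w) \<le> t * c" if "t > 0" for t :: real
      using *[of t] that by (simp add: c_def[symmetric] power2_eq_square)
    \<comment> \<open>A step \<open>t\<close> so small that the quadratic term cannot compensate the linear one.\<close>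
    moreover have "0 < (w \<bullet> w) / (\<bar>c\<bar> + 1)"
      using pos by (intro divide_pos_pos) auto
    ultimately have "2 * (w \<bullet> w) \<le> (w \<bullet> w) / (\<bar>c\<bar> + 1) * c" by blast
    also have "\<dots> \<le> (w \<bullet> w) / (\<bar>c\<bar> + 1) * (\<bar>c\<bar> + 1)"
      using pos by (intro mult_left_mono) auto
    also have "\<dots> = w \<bullet> w" by simp
    finally show False using pos by simp
  qed
  then have "w = 0"
    by (metis inner_gt_zero_iff not_le)
  then show ?thesis
    using that[of v \<mu>] vv by (simp add: w_def)
qed

lemma sym_mats_orthonormal_eigenbasis:
  fixes A :: "real ^ 'm ^ 'm"
  assumes A: "A \<in> sym_mats" and V: "subspace V" and inv: "\<And>v. v \<in> V \<Longrightarrow> A *v v \<in> V"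
  shows "\<exists>B\<subseteq>V. finite B \<and> card B = dim V \<and> pairwise orthogonal B \<and>
           (\<forall>v\<in>B. norm v = 1 \<and> (\<exists>\<mu>. A *v v = \<mu> *\<^sub>R v))"
  using V inv
proof (induction "dim V" arbitrary: V)
  case 0
  then show ?case by (intro exI[of _ "{}"]) auto
next
  case (Suc n)
  have "V \<noteq> {0}" using Suc.hyps(2) by auto
  then obtain v \<mu> where v: "v \<in> V" "norm v = 1" "A *v v = \<mu> *\<^sub>R v"
    using sym_mats_eigenvector[OF A Suc.prems(1)] Suc.prems(2) by metis
  \<comment> \<open>The orthogonal complement of \<open>v\<close> in \<open>V\<close> is again invariant.\<close>
  define W where "W = {y \<in> V. \<forall>x \<in> span {v}. orthogonal x y}"
  have W: "W = {y \<in> V. v \<bullet> y = 0}"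
    by (auto simp: W_def orthogonal_def span_singleton)
  have v0: "v \<noteq> 0" using v by auto
  have "dim W + dim (span {v}) = dim V"
    unfolding W_def using Suc.prems(1) v
    by (intro dim_subspace_orthogonal_to_vectors) (auto simp: span_minimal subspace_span)
  then have n: "n = dim W"
    using Suc.hyps(2) v0 by (simp add: dim_singleton)
  have "subspace W"
    using Suc.prems(1) by (auto simp: W subspace_def inner_add_right)
  moreover have "A *v y \<in> W" if "y \<in> W" for y
    using that Suc.prems(2) v inner_mult_sym_mats[OF A, of v y] by (auto simp: W)
  ultimately obtain B where B: "B \<subseteq> W" "finite B" "card B = dim W" "pairwise orthogonal B"
      "\<forall>v\<in>B. norm v = 1 \<and> (\<exists>\<mu>. A *v v = \<mu> *\<^sub>R v)"
    using Suc.hyps(1)[OF n] by blast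
  have "v \<notin> B"
    using B(1) v0 by (auto simp: W)
  then show ?case
    using B v Suc.hyps(2) n
    by (intro exI[of _ "insert v B"])
       (auto simp: W pairwise_insert orthogonal_def inner_commute)
qed

text \<open>
  The diagonal matrix with entries \<open>d i\<close>.
\<close>

definition diag_mat :: "('m \<Rightarrow> real) \<Rightarrow> real ^ 'm ^ 'm" where
  "diag_mat d = (\<chi> i j. if i = j then d i else 0)"

lemma diag_mat_mult: "diag_mat c ** diag_mat d = diag_mat (\<lambda>i. c i * d i)"
proof -
  have "(diag_mat c ** diag_mat d) $ i $ j = (\<Sum>k\<in>UNIV. if k = i then c i * diag_mat d $ i $ j else 0)"
    for i j
    unfolding matrix_matrix_mult_def vec_lambda_beta
    by (rule sum.cong) (auto simp: diag_mat_def)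
  then show ?thesis
    by (simp add: diag_mat_def vec_eq_iff)
qed

lemma diag_mat_one: "diag_mat (\<lambda>i. 1) = mat 1"
  by (simp add: diag_mat_def mat_def)

lemma det_diag_mat: "det (diag_mat d) = (\<Prod>i\<in>UNIV. d i)"
  by (subst det_diagonal) (auto simp: diag_mat_def)

lemma trace_diag_mat: "trace (diag_mat d) = (\<Sum>i\<in>UNIV. d i)"
  by (simp add: trace_def diag_mat_def)

lemma diag_mat_mult_vec: "(diag_mat d *v x) $ i = d i * x $ i"
  by (simp add: diag_mat_def matrix_vector_mult_def if_distrib[of "\<lambda>z. z * _"] cong: if_cong)

lemma diag_mat_scale_diff:
  "a *\<^sub>R diag_mat c - diag_mat d = diag_mat (\<lambda>i. a * c i - d i)"
  by (simp add: diag_mat_def vec_eq_iff)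

lemma sym_mats_spectral:
  fixes A :: "real ^ 'm ^ 'm"
  assumes A: "A \<in> sym_mats"
  obtains Q d where "orthogonal_matrix Q" "A = Q ** diag_mat d ** transpose Q"
proof -
  obtain B where B: "finite B" "card B = CARD('m)" "pairwise orthogonal B"
      "\<forall>v\<in>B. norm v = 1 \<and> (\<exists>\<mu>. A *v v = \<mu> *\<^sub>R v)"
    using sym_mats_orthonormal_eigenbasis[OF A subspace_UNIV] by auto
  obtain f :: "'m \<Rightarrow> real ^ 'm" where f: "bij_betw f UNIV B"
    using finite_same_card_bij[of "UNIV :: 'm set" B] B by auto
  then have "\<exists>\<mu>. A *v f j = \<mu> *\<^sub>R f j" for j
    using B(4) by (auto simp: bij_betw_def)
  then obtain d where d: "\<And>j. A *v f j = d j *\<^sub>R f j" by metis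
  define Q :: "real ^ 'm ^ 'm" where "Q = (\<chi> i j. f j $ i)"
  have col: "column j Q = f j" for j
    by (simp add: Q_def column_def)
  have "f i \<noteq> f j" if "i \<noteq> j" for i j
    using f that by (auto simp: bij_betw_def inj_on_def)
  then have Q: "orthogonal_matrix Q"
    using f B by (auto simp: orthogonal_matrix_orthonormal_columns col bij_betw_def pairwise_def)
  have "(A ** Q) $ i $ j = (Q ** diag_mat d) $ i $ j" for i j
  proof -
    have "(A ** Q) $ i $ j = (A *v f j) $ i"
      by (simp add: matrix_matrix_mult_def matrix_vector_mult_def Q_def)
    also have "\<dots> = (Q ** diag_mat d) $ i $ j"
      by (simp add: d Q_def diag_mat_def matrix_matrix_mult_def if_distrib[of "\<lambda>z. _ * z"]
          mult.commute cong: if_cong)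
    finally show ?thesis .
  qed
  then have "A ** Q = Q ** diag_mat d"
    by (simp add: vec_eq_iff)
  then have "Q ** diag_mat d ** transpose Q = A ** (Q ** transpose Q)"
    by (simp only: matrix_mul_assoc)
  then have "A = Q ** diag_mat d ** transpose Q"
    using Q by (simp add: orthogonal_matrix_def)
  with Q show ?thesis by (rule that)
qed

section \<open>Positive definite matrices\<close>

lemma matrix_inv_eqI:
  fixes A B :: "real ^ 'm ^ 'm"
  assumes "A ** B = mat 1"
  shows "matrix_inv A = B"
proof -
  have BA: "B ** A = mat 1"
    using assms by (rule iffD1[OF matrix_left_right_inverse])
  have "A ** matrix_inv A = mat 1 \<and> matrix_inv A ** A = mat 1"
    unfolding matrix_inv_def using assms BA
    by (intro someI[of "\<lambda>A'. A ** A' = mat 1 \<and> A' ** A = mat 1" B] conjI)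
  then have AA: "A ** matrix_inv A = mat 1" ..
  have "matrix_inv A = (B ** A) ** matrix_inv A"
    by (simp only: BA matrix_mul_lid)
  also have "\<dots> = B"
    by (simp only: matrix_mul_assoc[symmetric] AA matrix_mul_rid)
  finally show ?thesis .
qed

lemma pd_mats_imp_sym: "P \<in> pd_mats \<Longrightarrow> P \<in> sym_mats"
  by (simp add: pd_mats_def)

lemma pd_mats_invertible:
  fixes P :: "real ^ 'm ^ 'm"
  assumes "P \<in> pd_mats"
  shows "P ** matrix_inv P = mat 1" "matrix_inv P ** P = mat 1"
proof -
  have "x = 0" if "P *v x = 0" for x
  proof (rule ccontr)
    assume "x \<noteq> 0"
    then have "0 < x \<bullet> (P *v x)"
      using assms by (simp add: pd_mats_def)
    then show False
      by (simp add: that)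
  qed
  then obtain B where BP: "B ** P = mat 1"
    using matrix_left_invertible_ker[of P] by metis
  then have PB: "P ** B = mat 1"
    by (rule iffD1[OF matrix_left_right_inverse])
  show "P ** matrix_inv P = mat 1" "matrix_inv P ** P = mat 1"
    unfolding matrix_inv_eqI[OF PB] by (rule PB BP)+
qed

lemma sym_mats_congruence:
  fixes P B :: "real ^ 'm ^ 'm"
  assumes "P \<in> sym_mats"
  shows "transpose B ** P ** B \<in> sym_mats"
  using assms by (simp add: sym_mats_def matrix_transpose_mul matrix_mul_assoc)

lemma pd_mats_congruence:
  fixes P B :: "real ^ 'm ^ 'm"
  assumes P: "P \<in> pd_mats" and B: "C ** B = mat 1"
  shows "transpose B ** P ** B \<in> pd_mats"
proof -
  have "0 < x \<bullet> ((transpose B ** P ** B) *v x)" if "x \<noteq> 0" for x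
  proof -
    have "B *v x \<noteq> 0"
    proof
      assume "B *v x = 0"
      then have "(C ** B) *v x = 0"
        by (simp only: matrix_vector_mul_assoc[symmetric] matrix_vector_mult_0_right)
      then show False using B that by simp
    qed
    then have "0 < (B *v x) \<bullet> (P *v (B *v x))"
      using P by (auto simp: pd_mats_def)
    also have "\<dots> = x \<bullet> ((transpose B ** P ** B) *v x)"
      by (metis dot_lmul_matrix matrix_vector_mul_assoc vector_transpose_matrix)
    finally show ?thesis .
  qed
  then show ?thesis
    using sym_mats_congruence[OF pd_mats_imp_sym[OF P]] by (simp add: pd_mats_def)
qed

lemma pd_mats_inverse:
  fixes P :: "real ^ 'm ^ 'm"
  assumes P: "P \<in> pd_mats"
  shows "matrix_inv P \<in> pd_mats"
proof -
  have "transpose (matrix_inv P) ** P = mat 1"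
    using arg_cong[OF pd_mats_invertible(1)[OF P], of transpose] pd_mats_imp_sym[OF P]
    by (simp add: matrix_transpose_mul sym_mats_def transpose_mat)
  then have "transpose (matrix_inv P) ** P ** matrix_inv P = matrix_inv P"
    by simp
  then show ?thesis
    using pd_mats_congruence[OF P pd_mats_invertible(1)[OF P]] by simp
qed

lemma pd_mats_diag:
  assumes "\<And>i. 0 < d i"
  shows "diag_mat d \<in> pd_mats"
proof -
  have "0 < x \<bullet> (diag_mat d *v x)" if x: "x \<noteq> 0" for x
  proof -
    obtain i where i: "x $ i \<noteq> 0" using x by (auto simp: vec_eq_iff)
    have "0 < (\<Sum>i\<in>UNIV. d i * (x $ i)\<^sup>2)"
      using assms i by (intro sum_pos2[of _ i]) (auto simp: less_imp_le)
    then show ?thesis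
      by (simp add: inner_vec_def diag_mat_mult_vec power2_eq_square mult_ac)
  qed
  moreover have "diag_mat d \<in> sym_mats"
    by (simp add: sym_mats_def diag_mat_def transpose_def vec_eq_iff)
  ultimately show ?thesis
    by (simp add: pd_mats_def)
qed

lemma pd_mats_spectral:
  fixes P :: "real ^ 'm ^ 'm"
  assumes P: "P \<in> pd_mats"
  obtains Q d where "orthogonal_matrix Q" "P = Q ** diag_mat d ** transpose Q" "\<And>i. 0 < d i"
proof -
  obtain Q d where Q: "orthogonal_matrix Q" and PQ: "P = Q ** diag_mat d ** transpose Q"
    using sym_mats_spectral pd_mats_imp_sym[OF P] by blast
  have QQ: "transpose Q ** Q = mat 1" "Q ** transpose Q = mat 1"
    using Q by (auto simp: orthogonal_matrix_def)
  have "transpose Q ** P ** Q = transpose Q ** Q ** diag_mat d ** (transpose Q ** Q)"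
    by (simp add: PQ matrix_mul_assoc)
  then have "diag_mat d = transpose Q ** P ** Q"
    by (simp add: QQ)
  then have D: "diag_mat d \<in> pd_mats"
    using pd_mats_congruence[OF P QQ(1)] by simp
  have "0 < d i" for i
  proof -
    have "0 < axis i 1 \<bullet> (diag_mat d *v axis i 1)"
      using D by (auto simp: pd_mats_def axis_eq_0_iff)
    then show ?thesis
      by (simp add: inner_axis' diag_mat_mult_vec)
  qed
  then show ?thesis by (rule that[OF Q PQ])
qed

section \<open>Concavity of the log-determinant\<close>

lemma orthogonal_conjugate_mult:
  fixes Q :: "real ^ 'm ^ 'm"
  assumes "orthogonal_matrix Q"
  shows "(Q ** X ** transpose Q) ** (Q ** Y ** transpose Q) = Q ** (X ** Y) ** transpose Q"
proof -
  have "(Q ** X ** transpose Q) ** (Q ** Y ** transpose Q)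
      = Q ** X ** (transpose Q ** Q) ** Y ** transpose Q"
    by (simp only: matrix_mul_assoc)
  also have "\<dots> = Q ** (X ** Y) ** transpose Q"
    using assms by (simp only: orthogonal_matrix_def matrix_mul_rid matrix_mul_assoc)
  finally show ?thesis .
qed

lemma pd_mats_orthogonal_diag:
  fixes Q :: "real ^ 'm ^ 'm"
  assumes Q: "orthogonal_matrix Q" and d: "\<And>i. 0 < d i"
  shows "Q ** diag_mat d ** transpose Q \<in> pd_mats"
  using pd_mats_congruence[OF pd_mats_diag[of d, OF d], of Q "transpose Q"] Q
  by (simp add: orthogonal_matrix_def)

lemma pd_mats_sqrt:
  fixes P :: "real ^ 'm ^ 'm"
  assumes P: "P \<in> pd_mats"
  obtains W where "W \<in> pd_mats" "W ** W = P"
proof -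
  obtain Q d where Q: "orthogonal_matrix Q" and PQ: "P = Q ** diag_mat d ** transpose Q"
      and d: "\<And>i. 0 < d i"
    using pd_mats_spectral[OF P] by metis
  define W where "W = Q ** diag_mat (\<lambda>i. sqrt (d i)) ** transpose Q"
  have "W ** W = P"
    using d by (simp add: W_def orthogonal_conjugate_mult[OF Q] diag_mat_mult PQ less_imp_le)
  moreover have "W \<in> pd_mats"
    unfolding W_def using d by (intro pd_mats_orthogonal_diag Q) simp
  ultimately show ?thesis by (intro that)
qed

lemma
  fixes P :: "real ^ 'm ^ 'm"
  assumes P: "P \<in> pd_mats"
  shows pd_mats_det_pos: "0 < det P"
    and pd_mats_ln_det_le_trace: "ln (det P) \<le> trace P - real CARD('m)"
proof -
  obtain Q d where Q: "orthogonal_matrix Q" and PQ: "P = Q ** diag_mat d ** transpose Q"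
      and d: "\<And>i. 0 < d i"
    using pd_mats_spectral[OF P] by metis
  have "det P = det (diag_mat d) * (det Q * det (transpose Q))"
    by (simp add: PQ det_mul)
  also have "det Q * det (transpose Q) = 1"
    using Q by (simp only: det_mul[symmetric] orthogonal_matrix_def det_I)
  finally have det: "det P = (\<Prod>i\<in>UNIV. d i)"
    by (simp add: det_diag_mat)
  have "trace P = trace (transpose Q ** (Q ** diag_mat d))"
    unfolding PQ by (rule trace_mul_sym)
  also have "transpose Q ** (Q ** diag_mat d) = diag_mat d"
    using Q by (simp add: matrix_mul_assoc orthogonal_matrix_def)
  finally have tr: "trace P = (\<Sum>i\<in>UNIV. d i)"
    by (simp add: trace_diag_mat)
  show "0 < det P"
    unfolding det using d by (intro prod_pos) auto
  have "ln (det P) = (\<Sum>i\<in>UNIV. ln (d i))"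
    unfolding det using d by (subst ln_prod) (auto simp: less_imp_neq[symmetric])
  also have "\<dots> \<le> (\<Sum>i\<in>UNIV. d i - 1)"
    using d by (intro sum_mono ln_le_minus_one) auto
  finally show "ln (det P) \<le> trace P - real CARD('m)"
    by (simp add: tr sum_subtractf)
qed

lemma matrix_inv_sym_mats:
  "P \<in> pd_mats \<Longrightarrow> matrix_inv P \<in> sym_mats"
  by (intro pd_mats_imp_sym pd_mats_inverse)

text \<open>
  The graph of \<open>ln \<circ> det\<close> lies below each of its tangent planes. With \<open>W\<close> a positive
  definite square root of \<open>Z\<close>, this is the inequality \<open>ln (det N) \<le> trace N - CARD('m)\<close>
  for \<open>N\<close> the congruence of \<open>X\<close> by \<open>matrix_inv W\<close>.
\<close>

lemma ln_det_le_tangent: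
  fixes X Z :: "real ^ 'm ^ 'm"
  assumes X: "X \<in> pd_mats" and Z: "Z \<in> pd_mats"
  shows "ln (det X) - ln (det Z) \<le> matrix_inv Z \<bullet> (X - Z)"
proof -
  obtain W where W: "W \<in> pd_mats" and WW: "W ** W = Z"
    using pd_mats_sqrt[OF Z] .
  define V where "V = matrix_inv W"
  have V: "V \<in> pd_mats" and VW: "V ** W = mat 1" "W ** V = mat 1"
    using W by (simp_all add: V_def pd_mats_inverse pd_mats_invertible)
  have VT: "transpose V = V"
    using V by (simp add: pd_mats_def sym_mats_def)
  have ZV: "matrix_inv Z = V ** V"
  proof (rule matrix_inv_eqI)
    have "Z ** (V ** V) = W ** (W ** V) ** V"
      by (simp only: WW[symmetric] matrix_mul_assoc)
    then show "Z ** (V ** V) = mat 1"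
      by (simp add: VW)
  qed
  define N where "N = V ** X ** V"
  have N: "N \<in> pd_mats"
    unfolding N_def using pd_mats_congruence[OF X, of W V] VW VT by simp
  have "det V * det V * det Z = 1"
    using VW(1) by (metis (no_types, opaque_lifting) WW det_I det_mul mult.assoc mult.commute mult.right_neutral)
  moreover have "det N = det V * det V * det X"
    by (simp add: N_def det_mul)
  ultimately have "det N = det X / det Z"
    using pd_mats_det_pos[OF Z] by (simp add: field_simps)
  then have "ln (det X) - ln (det Z) = ln (det N)"
    using pd_mats_det_pos[OF Z] pd_mats_det_pos[OF X]
    by (simp add: ln_div)
  also have "\<dots> \<le> trace N - real CARD('m)"
    by (rule pd_mats_ln_det_le_trace[OF N])
  also have "trace N = trace (matrix_inv Z ** X)"
    unfolding N_def ZV by (subst trace_mul_sym) (simp add: matrix_mul_assoc)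
  also have "\<dots> = matrix_inv Z \<bullet> X"
    by (simp add: inner_sym_mats matrix_inv_sym_mats Z)
  also have "real CARD('m) = matrix_inv Z \<bullet> Z"
    by (simp add: inner_sym_mats matrix_inv_sym_mats Z pd_mats_invertible trace_I)
  finally show ?thesis
    by (simp add: inner_diff_right)
qed

text \<open>
  Adding the two tangent inequalities for the pairs \<open>(X, Z)\<close> and \<open>(Z, X)\<close> cancels the logarithms.
\<close>

lemma matrix_inv_antimono:
  fixes X Z :: "real ^ 'm ^ 'm"
  assumes "X \<in> pd_mats" "Z \<in> pd_mats"
  shows "(matrix_inv X - matrix_inv Z) \<bullet> (X - Z) \<le> 0"
  using ln_det_le_tangent[OF assms] ln_det_le_tangent[OF assms(2,1)]
  by (simp add: inner_diff_left inner_diff_right)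

lemma convex_pd_mats:
  fixes X Y :: "real ^ 'm ^ 'm"
  assumes "X \<in> pd_mats" "Y \<in> pd_mats" "0 < t" "t < 1"
  shows "t *\<^sub>R X + (1 - t) *\<^sub>R Y \<in> pd_mats"
proof -
  have "0 < x \<bullet> ((t *\<^sub>R X + (1 - t) *\<^sub>R Y) *v x)" if "x \<noteq> 0" for x
  proof -
    have "0 < x \<bullet> (X *v x)" "0 < x \<bullet> (Y *v x)"
      using assms that by (simp_all add: pd_mats_def)
    then show ?thesis
      using assms by (simp add: matrix_vector_mult_add_rdistrib scaleR_matrix_vector_assoc[symmetric]
          inner_add_right add_pos_pos)
  qed
  then show ?thesis
    using assms(1,2) by (simp add: pd_mats_def sym_mats_def transpose_def vec_eq_iff)
qed

text \<open>
  The tangent inequalities at the intermediate point, taken from both end points and averaged,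
  have right-hand sides that cancel.
\<close>

lemma ln_det_concave:
  fixes X Y :: "real ^ 'm ^ 'm"
  assumes X: "X \<in> pd_mats" and Y: "Y \<in> pd_mats" and t: "0 < t" "t < 1"
  shows "t * ln (det X) + (1 - t) * ln (det Y) \<le> ln (det (t *\<^sub>R X + (1 - t) *\<^sub>R Y))"
proof -
  define Z where "Z = t *\<^sub>R X + (1 - t) *\<^sub>R Y"
  have Z: "Z \<in> pd_mats"
    unfolding Z_def by (rule convex_pd_mats[OF assms])
  have "t * (ln (det X) - ln (det Z)) + (1 - t) * (ln (det Y) - ln (det Z))
      \<le> t * (matrix_inv Z \<bullet> (X - Z)) + (1 - t) * (matrix_inv Z \<bullet> (Y - Z))"
    using ln_det_le_tangent[OF X Z] ln_det_le_tangent[OF Y Z] t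
    by (intro add_mono mult_left_mono) auto
  also have "\<dots> = matrix_inv Z \<bullet> (t *\<^sub>R X + (1 - t) *\<^sub>R Y - Z)"
    by (simp add: inner_diff_right inner_add_right algebra_simps)
  also have "\<dots> = 0" by (simp add: Z_def)
  finally show ?thesis
    unfolding Z_def[symmetric] by (simp add: algebra_simps)
qed

lemma strict_convex_norm_square:
  fixes X Y :: "'a :: real_inner"
  assumes "X \<noteq> Y" "0 < t" "t < 1"
  shows "(t *\<^sub>R X + (1 - t) *\<^sub>R Y) \<bullet> (t *\<^sub>R X + (1 - t) *\<^sub>R Y) < t * (X \<bullet> X) + (1 - t) * (Y \<bullet> Y)"
proof -
  have "t * (X \<bullet> X) + (1 - t) * (Y \<bullet> Y) - (t *\<^sub>R X + (1 - t) *\<^sub>R Y) \<bullet> (t *\<^sub>R X + (1 - t) *\<^sub>R Y)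
      = t * (1 - t) * ((X - Y) \<bullet> (X - Y))"
    by (simp add: inner_diff_left inner_diff_right inner_add_left inner_add_right
        inner_commute[of Y X] algebra_simps power2_eq_square)
  moreover have "0 < t * (1 - t) * ((X - Y) \<bullet> (X - Y))"
    using assms by simp
  ultimately show ?thesis by linarith
qed

section \<open>Openness of the cone and continuity of inversion\<close>

lemma norm_matrix_vector_mult_le:
  fixes A :: "real ^ 'm ^ 'm"
  shows "norm (A *v x) \<le> norm A * norm x"
proof -
  have "norm (A *v x) = L2_set (\<lambda>i. \<bar>A $ i \<bullet> x\<bar>) UNIV"
    by (simp add: norm_vec_def matrix_vector_mult_def inner_vec_def)
  also have "\<dots> \<le> L2_set (\<lambda>i. norm (A $ i) * norm x) UNIV"
    by (intro L2_set_mono Cauchy_Schwarz_ineq2) auto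
  also have "\<dots> = norm A * norm x"
    by (simp add: L2_set_left_distrib norm_vec_def[of A])
  finally show ?thesis .
qed

text \<open>
  The radius of the ball is the least value of the quadratic form of \<open>Z\<close> on the unit sphere.
\<close>

lemma pd_mats_open_in_sym_mats:
  fixes Z :: "real ^ 'm ^ 'm"
  assumes Z: "Z \<in> pd_mats"
  obtains e where "0 < e" "ball Z e \<inter> sym_mats \<subseteq> pd_mats"
proof -
  have "continuous_on (sphere 0 1) (\<lambda>x. x \<bullet> (Z *v x))"
    by (intro continuous_intros)
  then obtain v where v: "v \<in> sphere 0 1"
      and min: "\<And>x. x \<in> sphere 0 1 \<Longrightarrow> v \<bullet> (Z *v v) \<le> x \<bullet> (Z *v x)"
    using continuous_attains_inf[of "sphere 0 1" "\<lambda>x. x \<bullet> (Z *v x)"] by auto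
  define e where "e = v \<bullet> (Z *v v)"
  have "v \<noteq> 0" using v by auto
  then have e: "0 < e"
    using Z by (simp add: e_def pd_mats_def)
  have "Y \<in> pd_mats" if Y: "Y \<in> ball Z e \<inter> sym_mats" for Y
  proof -
    have "0 < x \<bullet> (Y *v x)" if x: "x \<noteq> 0" for x
    proof -
      define y where "y = (1 / norm x) *\<^sub>R x"
      have y: "norm y = 1" using x by (simp add: y_def)
      have "\<bar>y \<bullet> ((Y - Z) *v y)\<bar> \<le> norm (Y - Z)"
        using Cauchy_Schwarz_ineq2[of y "(Y - Z) *v y"] norm_matrix_vector_mult_le[of "Y - Z" y] y
        by simp
      moreover have "norm (Y - Z) < e"
        using Y by (simp add: dist_norm norm_minus_commute)
      moreover have "e \<le> y \<bullet> (Z *v y)"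
        unfolding e_def using y by (intro min) simp
      moreover have "y \<bullet> (Y *v y) = y \<bullet> (Z *v y) + y \<bullet> ((Y - Z) *v y)"
        by (simp add: matrix_vector_mult_diff_rdistrib inner_diff_right)
      ultimately have "0 < y \<bullet> (Y *v y)" by linarith
      then show ?thesis
        using x by (simp add: y_def matrix_vector_mult_scaleR zero_less_mult_iff zero_less_divide_iff)
    qed
    then show ?thesis
      using Y by (simp add: pd_mats_def)
  qed
  with e that show ?thesis by blast
qed

lemma continuous_on_det:
  fixes f :: "'a :: topological_space \<Rightarrow> real ^ 'm ^ 'm"
  assumes "\<And>i j. continuous_on S (\<lambda>x. f x $ i $ j)"
  shows "continuous_on S (\<lambda>x. det (f x))"
  unfolding det_def by (intro continuous_intros assms)

lemma continuous_on_matrix_inv: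
  fixes S :: "(real ^ 'm ^ 'm) set"
  assumes "\<And>A. A \<in> S \<Longrightarrow> invertible A"
  shows "continuous_on S matrix_inv"
proof -
  \<comment> \<open>Cramer's rule: \<open>A\<close> with its \<open>k\<close>-th column replaced by the \<open>j\<close>-th unit vector.\<close>
  define c where "c j k A = (\<chi> i l. if l = k then axis j 1 $ i else A $ i $ l)"
    for j k and A :: "real ^ 'm ^ 'm"
  have cramer': "matrix_inv A $ k $ j = det (c j k A) / det A" if A: "A \<in> S" for A k j
  proof -
    have "A ** matrix_inv A = mat 1"
      using assms[OF A] matrix_inv_eqI unfolding invertible_def by metis
    then have "A *v (matrix_inv A *v axis j 1) = axis j 1"
      by (simp add: matrix_vector_mul_assoc)
    then have "matrix_inv A *v axis j 1 = (\<chi> k. det (c j k A) / det A)"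
      using assms[OF A] unfolding c_def by (subst cramer[symmetric]) (auto simp: invertible_det_nz)
    then show ?thesis
      by (simp add: vec_eq_iff matrix_vector_mul_component inner_axis)
  qed
  have "continuous_on S (\<lambda>A. det (c j k A) / det A)" for j k
  proof (intro continuous_on_divide continuous_on_det ballI)
    show "continuous_on S (\<lambda>A. c j k A $ i $ l)" for i l
      by (cases "l = k") (auto simp: c_def intro!: continuous_intros)
  qed (use assms in \<open>auto simp: invertible_det_nz intro!: continuous_intros\<close>)
  then have "continuous_on S (\<lambda>A. matrix_inv A $ k $ j)" for j k
    by (simp add: cramer' cong: continuous_on_cong)
  then have "continuous_on S (\<lambda>A. \<chi> k j. matrix_inv A $ k $ j)"
    by (intro continuous_on_vec_lambda)
  then show ?thesis by simp
qed

lemma continuous_on_pd_matrix_inv: "continuous_on pd_mats matrix_inv"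
  by (intro continuous_on_matrix_inv) (auto simp: invertible_def intro: pd_mats_invertible)

section \<open>The derivative of the log-determinant\<close>

text \<open>
  The tangent inequalities for the pairs \<open>(X, Z)\<close> and \<open>(Z, X)\<close> bound the absolute linearisation
  error by \<open>norm (matrix_inv X - matrix_inv Z) * norm (X - Z)\<close>, which is \<open>o(norm (X - Z))\<close> because
  inversion is continuous. No formula for the derivative of the determinant is used.
\<close>

lemma ln_det_has_derivative:
  fixes Z :: "real ^ 'm ^ 'm"
  assumes Z: "Z \<in> pd_mats"
  shows "((\<lambda>X. ln (det X)) has_derivative (\<lambda>H. matrix_inv Z \<bullet> H)) (at Z within pd_mats)"
  unfolding has_derivative_within
proof (intro conjI bounded_linear_inner_right)
  let ?r = "\<lambda>X. (1 / norm (X - Z)) *\<^sub>R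
    (ln (det X) - (ln (det Z) + matrix_inv Z \<bullet> (X - Z)))"
  have "(matrix_inv \<longlongrightarrow> matrix_inv Z) (at Z within pd_mats)"
    using continuous_on_pd_matrix_inv Z unfolding continuous_on_def by blast
  then have lim: "((\<lambda>X. norm (matrix_inv X - matrix_inv Z)) \<longlongrightarrow> 0) (at Z within pd_mats)"
    by (intro tendsto_norm_zero) (simp add: LIM_zero_iff)
  have "norm (?r X) \<le> norm (matrix_inv X - matrix_inv Z)" if X: "X \<in> pd_mats" "X \<noteq> Z" for X
  proof -
    have "\<bar>ln (det X) - (ln (det Z) + matrix_inv Z \<bullet> (X - Z))\<bar>
        \<le> - ((matrix_inv X - matrix_inv Z) \<bullet> (X - Z))"
      using ln_det_le_tangent[OF X(1) Z] ln_det_le_tangent[OF Z X(1)]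
      by (simp add: inner_diff_left inner_diff_right)
    also have "\<dots> \<le> norm (matrix_inv X - matrix_inv Z) * norm (X - Z)"
      using Cauchy_Schwarz_ineq2[of "matrix_inv X - matrix_inv Z" "X - Z"] by linarith
    finally show ?thesis
      using X by (simp add: field_simps)
  qed
  then have "\<forall>\<^sub>F X in at Z within pd_mats. norm (?r X) \<le> norm (matrix_inv X - matrix_inv Z)"
    by (simp add: eventually_at_filter)
  then show "(?r \<longlongrightarrow> 0) (at Z within pd_mats)"
    by (rule Lim_null_comparison[OF _ lim])
qed

section \<open>Interior and boundary of the positive definite cone\<close>

lemma sym_mats_not_pd_eigenvector:
  fixes S :: "real ^ 'm ^ 'm"
  assumes S: "S \<in> sym_mats" "S \<notin> pd_mats"
  obtains x \<mu> where "x \<noteq> 0" "\<mu> \<le> 0" "S *v x = \<mu> *\<^sub>R x"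
proof -
  obtain Q d where Q: "orthogonal_matrix Q" and SQ: "S = Q ** diag_mat d ** transpose Q"
    using sym_mats_spectral[OF S(1)] by metis
  then obtain i where i: "d i \<le> 0"
    using pd_mats_orthogonal_diag[OF Q, of d] S(2) not_le by blast
  define x where "x = Q *v axis i 1"
  have QQ: "transpose Q ** Q = mat 1"
    using Q by (simp add: orthogonal_matrix_def)
  have Qx: "transpose Q *v x = axis i 1"
    by (simp add: x_def matrix_vector_mul_assoc QQ)
  then have "x \<noteq> 0"
    by (metis axis_eq_0_iff matrix_vector_mult_0_right zero_neq_one)
  moreover have "diag_mat d *v axis i 1 = d i *\<^sub>R axis i 1"
    by (simp add: vec_eq_iff diag_mat_mult_vec axis_def)
  then have "S *v x = d i *\<^sub>R x"
    by (simp only: SQ matrix_vector_mul_assoc[symmetric] Qx matrix_vector_mult_scaleR)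
       (simp only: x_def)
  ultimately show ?thesis
    using i that by blast
qed

lemma psd_mats_not_pd_kernel:
  fixes S :: "real ^ 'm ^ 'm"
  assumes S: "S \<in> psd_mats" "S \<notin> pd_mats"
  obtains x where "x \<noteq> 0" "S *v x = 0"
proof -
  have "S \<in> sym_mats"
    using S by (simp add: psd_mats_def)
  then obtain x \<mu> where x: "x \<noteq> 0" "\<mu> \<le> 0" "S *v x = \<mu> *\<^sub>R x"
    using sym_mats_not_pd_eigenvector S(2) by metis
  have "0 \<le> x \<bullet> (S *v x)"
    using S by (simp add: psd_mats_def)
  then have "0 \<le> \<mu> * (x \<bullet> x)"
    using x by simp
  moreover have "0 < x \<bullet> x"
    using x by simp
  ultimately have "\<mu> = 0"
    using x(2) by (simp add: zero_le_mult_iff)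
  with x that show ?thesis by simp
qed

lemma closed_psd_mats: "closed (psd_mats :: (real ^ 'm ^ 'm) set)"
proof -
  have eq: "psd_mats = {A :: real ^ 'm ^ 'm. transpose A = A} \<inter> (\<Inter>x. {A. 0 \<le> x \<bullet> (A *v x)})"
    by (auto simp: psd_mats_def sym_mats_def)
  have sym: "closed {A :: real ^ 'm ^ 'm. transpose A = A}"
    unfolding transpose_def by (intro closed_Collect_eq continuous_intros continuous_on_vec_lambda)
  have "closed {A :: real ^ 'm ^ 'm. 0 \<le> x \<bullet> (A *v x)}" for x
    unfolding matrix_vector_mult_def inner_vec_def vec_lambda_beta inner_real_def
    by (intro closed_Collect_le continuous_intros)
  then show ?thesis
    unfolding eq by (intro closed_Int closed_INT ballI sym)
qed

lemma pd_mats_subset_psd_mats: "pd_mats \<subseteq> psd_mats"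
proof
  fix A :: "real ^ 'm ^ 'm"
  assume A: "A \<in> pd_mats"
  have "0 \<le> x \<bullet> (A *v x)" for x
    using A by (cases "x = 0") (simp_all add: pd_mats_def less_imp_le)
  then show "A \<in> psd_mats"
    using A by (simp add: psd_mats_def pd_mats_def)
qed

lemma openin_sym_mats_pd_mats: "openin (top_of_set sym_mats) pd_mats"
  unfolding openin_contains_ball
  using pd_mats_open_in_sym_mats pd_mats_imp_sym by (metis subsetI)

lemma sym_interior_pd_mats: "sym_interior pd_mats = pd_mats"
  unfolding sym_interior_def by (rule interior_of_openin[OF openin_sym_mats_pd_mats])

lemma sym_frontier_pd_mats: "S \<in> sym_frontier pd_mats \<Longrightarrow> S \<notin> pd_mats"
  unfolding sym_frontier_def frontier_of_def
  by (simp add: interior_of_openin[OF openin_sym_mats_pd_mats])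

text \<open>
  Since the cone is relatively open, limits and derivatives at its points within the symmetric
  matrices only see positive definite matrices, where \<open>F\<close> is given by the formula.
\<close>

lemma at_within_sym_mats:
  fixes X :: "real ^ 'm ^ 'm"
  assumes X: "X \<in> pd_mats"
  shows "at X within sym_mats = at X within pd_mats"
proof -
  obtain e where e: "0 < e" "ball X e \<inter> sym_mats \<subseteq> pd_mats"
    using pd_mats_open_in_sym_mats[OF X] .
  show ?thesis
  proof (rule at_within_nhd[of X "ball X e"])
    show "sym_mats \<inter> ball X e - {X} = pd_mats \<inter> ball X e - {X}"
      using e pd_mats_imp_sym by auto
  qed (use e in auto)
qed

section \<open>The regularised negative log-determinant\<close>

text \<open>
  The real-valued formula \<open>- ln (det S) + lam / 2 * trace (S ** S)\<close>, meaningful for positive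
  definite \<open>S\<close>.
\<close>

definition reg_neg_log_det :: "real \<Rightarrow> real ^ 'm ^ 'm \<Rightarrow> real" where
  "reg_neg_log_det lam S = - ln (det S) + lam / 2 * trace (S ** S)"

lemma reg_neg_log_det_pd:
  "S \<in> pd_mats \<Longrightarrow> reg_neg_log_det lam S = - ln (det S) + lam / 2 * (S \<bullet> S)"
  by (simp add: reg_neg_log_det_def inner_sym_mats pd_mats_imp_sym)

lemma reg_neg_log_det_strict_convex:
  fixes X Y :: "real ^ 'm ^ 'm"
  assumes lam: "0 < lam" and XY: "X \<in> pd_mats" "Y \<in> pd_mats" "X \<noteq> Y" and t: "0 < t" "t < 1"
  shows "reg_neg_log_det lam (t *\<^sub>R X + (1 - t) *\<^sub>R Y)
       < t * reg_neg_log_det lam X + (1 - t) * reg_neg_log_det lam Y"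
proof -
  let ?Z = "t *\<^sub>R X + (1 - t) *\<^sub>R Y"
  have "lam / 2 * (?Z \<bullet> ?Z) < lam / 2 * (t * (X \<bullet> X) + (1 - t) * (Y \<bullet> Y))"
    using strict_convex_norm_square[OF XY(3) t] lam by (intro mult_strict_left_mono) auto
  moreover have "- l + lam / 2 * z < t * (- a + lam / 2 * p) + (1 - t) * (- b + lam / 2 * q)"
    if "lam / 2 * z < lam / 2 * (t * p + (1 - t) * q)" "t * a + (1 - t) * b \<le> l"
    for l z a b p q :: real
    using that by (simp add: algebra_simps diff_divide_distrib add_divide_distrib)
  ultimately show ?thesis
    using ln_det_concave[OF XY(1,2) t] unfolding reg_neg_log_det_pd[OF XY(1)]
      reg_neg_log_det_pd[OF XY(2)] reg_neg_log_det_pd[OF convex_pd_mats[OF XY(1,2) t]]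
    by blast
qed

lemma reg_neg_log_det_has_derivative:
  fixes X :: "real ^ 'm ^ 'm"
  assumes X: "X \<in> pd_mats"
  shows "(reg_neg_log_det lam has_derivative (\<lambda>H. (lam *\<^sub>R X - matrix_inv X) \<bullet> H))
           (at X within pd_mats)"
proof -
  have "((\<lambda>S. - ln (det S) + lam / 2 * (S \<bullet> S)) has_derivative
      (\<lambda>H. - (matrix_inv X \<bullet> H) + lam / 2 * (X \<bullet> H + H \<bullet> X))) (at X within pd_mats)"
    by (intro has_derivative_add has_derivative_minus ln_det_has_derivative[OF X]
        has_derivative_mult_right has_derivative_inner has_derivative_ident)
  also have "(\<lambda>H. - (matrix_inv X \<bullet> H) + lam / 2 * (X \<bullet> H + H \<bullet> X))
      = (\<lambda>H. (lam *\<^sub>R X - matrix_inv X) \<bullet> H)"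
    by (simp add: fun_eq_iff inner_diff_left) (simp add: inner_commute)
  finally have "((\<lambda>S. - ln (det S) + lam / 2 * (S \<bullet> S)) has_derivative
      (\<lambda>H. (lam *\<^sub>R X - matrix_inv X) \<bullet> H)) (at X within pd_mats)" .
  then show ?thesis
    by (rule has_derivative_transform[OF X, rotated]) (rule reg_neg_log_det_pd)
qed

text \<open>
  This gives lower semicontinuity off the cone. If \<open>X\<close> is not positive semidefinite, then neither
  are the matrices near it; otherwise \<open>det X = 0\<close>, so \<open>- ln (det Y)\<close> is large for positive definite
  \<open>Y\<close> near \<open>X\<close>.
\<close>

lemma reg_neg_log_det_eventually_large:
  fixes X :: "real ^ 'm ^ 'm"
  assumes lam: "0 \<le> lam" and X: "X \<notin> pd_mats"
  shows "\<forall>\<^sub>F Y in at X. Y \<in> pd_mats \<longrightarrow> K < reg_neg_log_det lam Y"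
proof (cases "X \<in> psd_mats")
  case False
  then have "\<forall>\<^sub>F Y in at X. Y \<in> - psd_mats"
    using closed_psd_mats eventually_at_topological by (metis ComplI open_Compl)
  then show ?thesis
    by eventually_elim (use pd_mats_subset_psd_mats in auto)
next
  case True
  obtain x where "x \<noteq> 0" "X *v x = 0"
    using psd_mats_not_pd_kernel[OF True X] .
  then have "det X = 0"
    using invertible_det_nz[of X] matrix_left_invertible_ker[of X] invertible_def[of X] by metis
  moreover have "isCont (\<lambda>Y :: real ^ 'm ^ 'm. det Y) X"
    using continuous_on_det[of UNIV "\<lambda>Y :: real ^ 'm ^ 'm. Y"]
    by (simp add: continuous_on_eq_continuous_at continuous_intros)
  ultimately have "((\<lambda>Y. det Y) \<longlongrightarrow> 0) (at X)"
    by (metis isCont_def)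
  then have "\<forall>\<^sub>F Y in at X. det Y < exp (- K)"
    by (rule order_tendstoD) simp
  then show ?thesis
  proof eventually_elim
    case (elim Y)
    show ?case
    proof
      assume Y: "Y \<in> pd_mats"
      then have "ln (det Y) < - K"
        using elim pd_mats_det_pos[OF Y] by (metis ln_exp ln_less_cancel_iff exp_gt_zero)
      moreover have "0 \<le> lam / 2 * (Y \<bullet> Y)"
        using lam by simp
      ultimately show "K < reg_neg_log_det lam Y"
        by (simp add: reg_neg_log_det_pd[OF Y])
    qed
  qed
qed

section \<open>The gradient map\<close>

lemma matrix_conjugate_diff:
  fixes P R X Y :: "real ^ 'm ^ 'm"
  shows "a *\<^sub>R (P ** X ** R) - P ** Y ** R = P ** (a *\<^sub>R X - Y) ** R"
proof -
  have "P ** (a *\<^sub>R X - Y) = a *\<^sub>R (P ** X) - P ** Y"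
    and "(a *\<^sub>R (P ** X) - P ** Y) ** R = a *\<^sub>R (P ** X ** R) - P ** Y ** R"
    by (simp_all add: matrix_matrix_mult_def vec_eq_iff algebra_simps sum_subtractf sum_distrib_left)
  then show ?thesis by simp
qed

text \<open>
  Injectivity is strong monotonicity of the map. For surjectivity, diagonalising the target with
  eigenvalues \<open>y i\<close> reduces the equation to \<open>lam * s - 1 / s = y i\<close>, which has a positive root.
\<close>

lemma reg_gradient_bij:
  assumes lam: "0 < lam"
  shows "bij_betw (\<lambda>S :: real ^ 'm ^ 'm. lam *\<^sub>R S - matrix_inv S) pd_mats sym_mats"
proof (rule bij_betw_imageI)
  show "inj_on (\<lambda>S :: real ^ 'm ^ 'm. lam *\<^sub>R S - matrix_inv S) pd_mats"
  proof (rule inj_onI)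
    fix X Y :: "real ^ 'm ^ 'm"
    assume XY: "X \<in> pd_mats" "Y \<in> pd_mats" "lam *\<^sub>R X - matrix_inv X = lam *\<^sub>R Y - matrix_inv Y"
    then have "matrix_inv X - matrix_inv Y = lam *\<^sub>R (X - Y)"
      by (simp add: algebra_simps)
    then have "lam * ((X - Y) \<bullet> (X - Y)) \<le> 0"
      using matrix_inv_antimono[OF XY(1,2)] by simp
    then have "(X - Y) \<bullet> (X - Y) \<le> 0"
      using lam by (simp add: mult_le_0_iff)
    then show "X = Y"
      by (metis inner_gt_zero_iff not_le right_minus_eq)
  qed
  show "(\<lambda>S :: real ^ 'm ^ 'm. lam *\<^sub>R S - matrix_inv S) ` pd_mats = sym_mats"
  proof (intro equalityI subsetI)
    fix Y :: "real ^ 'm ^ 'm"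
    assume "Y \<in> (\<lambda>S. lam *\<^sub>R S - matrix_inv S) ` pd_mats"
    then obtain S where S: "S \<in> pd_mats" "Y = lam *\<^sub>R S - matrix_inv S" by blast
    then show "Y \<in> sym_mats"
      using pd_mats_imp_sym[OF S(1)] matrix_inv_sym_mats[OF S(1)]
      by (simp add: sym_mats_def transpose_def vec_eq_iff)
  next
    fix Y :: "real ^ 'm ^ 'm"
    assume "Y \<in> sym_mats"
    then obtain Q y where Q: "orthogonal_matrix Q" and Y: "Y = Q ** diag_mat y ** transpose Q"
      using sym_mats_spectral by metis
    \<comment> \<open>The positive root of \<open>lam * s\<^sup>2 - y i * s - 1 = 0\<close>.\<close>
    define s where "s i = (y i + sqrt ((y i)\<^sup>2 + 4 * lam)) / (2 * lam)" for i
    have pos: "0 < s i" for i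
    proof -
      have "\<bar>y i\<bar> < sqrt ((y i)\<^sup>2 + 4 * lam)"
        using lam by (intro real_less_rsqrt) simp
      then show ?thesis
        using lam by (simp add: s_def)
    qed
    have root: "lam * s i - 1 / s i = y i" for i
    proof -
      have "(2 * lam * s i - y i)\<^sup>2 = (y i)\<^sup>2 + 4 * lam"
        using lam by (simp add: s_def)
      then have "4 * lam * (lam * (s i)\<^sup>2 - y i * s i - 1) = 0"
        by (simp add: power2_eq_square algebra_simps)
      then have "lam * (s i)\<^sup>2 - y i * s i - 1 = 0"
        using lam by simp
      then show ?thesis
        using pos[of i] by (simp add: field_simps power2_eq_square)
    qed
    define S where "S = Q ** diag_mat s ** transpose Q"
    have S: "S \<in> pd_mats"
      unfolding S_def by (rule pd_mats_orthogonal_diag[OF Q pos])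
    have "(\<lambda>i. s i * (1 / s i)) = (\<lambda>i. 1)"
      using pos by (auto simp: fun_eq_iff less_imp_neq[symmetric])
    then have "S ** (Q ** diag_mat (\<lambda>i. 1 / s i) ** transpose Q) = mat 1"
      using Q unfolding S_def orthogonal_conjugate_mult[OF Q] diag_mat_mult
      by (simp add: diag_mat_one orthogonal_matrix_def)
    then have "matrix_inv S = Q ** diag_mat (\<lambda>i. 1 / s i) ** transpose Q"
      by (rule matrix_inv_eqI)
    then have "lam *\<^sub>R S - matrix_inv S
        = Q ** (lam *\<^sub>R diag_mat s - diag_mat (\<lambda>i. 1 / s i)) ** transpose Q"
      by (simp only: S_def matrix_conjugate_diff)
    also have "\<dots> = Y"
      unfolding diag_mat_scale_diff root Y by simp
    finally show "Y \<in> (\<lambda>S. lam *\<^sub>R S - matrix_inv S) ` pd_mats"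
      using S by blast
  qed
qed

text \<open>
  The limit is singular. If \<open>x \<noteq> 0\<close> is in its kernel, then \<open>\<Sigma> k *v x\<close> tends to \<open>0\<close> although
  \<open>matrix_inv (\<Sigma> k)\<close> sends it back to \<open>x\<close>.
\<close>

lemma norm_matrix_inv_at_top:
  fixes \<Sigma> :: "nat \<Rightarrow> real ^ 'm ^ 'm"
  assumes pd: "\<And>k. \<Sigma> k \<in> pd_mats" and lim: "\<Sigma> \<longlonglongrightarrow> S" and S: "S \<notin> pd_mats"
  shows "filterlim (\<lambda>k. norm (matrix_inv (\<Sigma> k))) at_top sequentially"
proof -
  have "S \<in> psd_mats"
    using closed_psd_mats pd pd_mats_subset_psd_mats
    by (intro closed_sequentially[OF _ _ lim]) auto
  then obtain x where x: "x \<noteq> 0" "S *v x = 0"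
    using psd_mats_not_pd_kernel S by metis
  have inv: "x = matrix_inv (\<Sigma> k) *v (\<Sigma> k *v x)" for k
    by (simp add: matrix_vector_mul_assoc pd_mats_invertible pd)
  have pos: "0 < norm (\<Sigma> k *v x)" for k
    using inv[of k] x by (metis matrix_vector_mult_0_right zero_less_norm_iff)
  have "(\<lambda>k. norm (\<Sigma> k - S) * norm x) \<longlonglongrightarrow> 0 * norm x"
    by (intro tendsto_mult tendsto_const tendsto_norm_zero) (use lim in \<open>simp add: LIM_zero_iff\<close>)
  moreover have "norm (norm (\<Sigma> k *v x)) \<le> norm (\<Sigma> k - S) * norm x" for k
    using norm_matrix_vector_mult_le[of "\<Sigma> k - S" x] x
    by (simp add: matrix_vector_mult_diff_rdistrib)
  ultimately have "(\<lambda>k. norm (\<Sigma> k *v x)) \<longlonglongrightarrow> 0"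
    using Lim_null_comparison[of "\<lambda>k. norm (\<Sigma> k *v x)" "\<lambda>k. norm (\<Sigma> k - S) * norm x"] by simp
  then have "filterlim (\<lambda>k. norm (\<Sigma> k *v x)) (at_right 0) sequentially"
    using pos by (simp add: filterlim_at)
  then have "filterlim (\<lambda>k. inverse (norm (\<Sigma> k *v x))) at_top sequentially"
    by (rule filterlim_compose[OF filterlim_inverse_at_top_right])
  then have "filterlim (\<lambda>k. norm x * inverse (norm (\<Sigma> k *v x))) at_top sequentially"
    using x by (intro filterlim_tendsto_pos_mult_at_top[OF tendsto_const]) auto
  moreover have "norm x * inverse (norm (\<Sigma> k *v x)) \<le> norm (matrix_inv (\<Sigma> k))" for k
    using norm_matrix_vector_mult_le[of "matrix_inv (\<Sigma> k)" "\<Sigma> k *v x"] inv[of k] pos[of k]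
    by (simp add: field_simps)
  ultimately show ?thesis
    by (auto intro: filterlim_at_top_mono)
qed

lemma norm_reg_gradient_at_top:
  fixes \<Sigma> :: "nat \<Rightarrow> real ^ 'm ^ 'm"
  assumes "\<And>k. \<Sigma> k \<in> pd_mats" and lim: "\<Sigma> \<longlonglongrightarrow> S" and "S \<notin> pd_mats"
  shows "filterlim (\<lambda>k. norm (lam *\<^sub>R \<Sigma> k - matrix_inv (\<Sigma> k))) at_top sequentially"
proof -
  have "(\<lambda>k. - norm (lam *\<^sub>R \<Sigma> k)) \<longlonglongrightarrow> - norm (lam *\<^sub>R S)"
    by (intro tendsto_intros lim)
  then have "filterlim (\<lambda>k. - norm (lam *\<^sub>R \<Sigma> k) + norm (matrix_inv (\<Sigma> k))) at_top sequentially"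
    using norm_matrix_inv_at_top[OF assms] by (rule filterlim_tendsto_add_at_top)
  moreover have "- norm (lam *\<^sub>R \<Sigma> k) + norm (matrix_inv (\<Sigma> k))
      \<le> norm (lam *\<^sub>R \<Sigma> k - matrix_inv (\<Sigma> k))" for k
    using norm_triangle_ineq2[of "matrix_inv (\<Sigma> k)" "lam *\<^sub>R \<Sigma> k"]
    by (simp add: norm_minus_commute)
  ultimately show ?thesis
    by (auto intro: filterlim_at_top_mono)
qed

section \<open>Membership in the class, essential smoothness and the gradient bijection\<close>

theorem proposition9p1:
  fixes F :: "real ^ 'm ^ 'm \<Rightarrow> ereal" and lam :: real
  assumes "lam > 0"
    and "\<And>S. S \<in> pd_mats \<Longrightarrow> F S = ereal (- ln (det S) + lam / 2 * trace (S ** S))"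
    and "\<And>S. S \<in> sym_mats - pd_mats \<Longrightarrow> F S = \<infinity>"
  shows "F \<in> class_E
    \<and> essentially_smooth F
    \<and> (\<forall>S\<in>pd_mats. has_sym_gradient F (lam *\<^sub>R S - matrix_inv S) S)
    \<and> (\<forall>S\<in>pd_mats. sym_gradient F S = lam *\<^sub>R S - matrix_inv S)
    \<and> bij_betw (sym_gradient F) pd_mats sym_mats"
proof -
  let ?G = "\<lambda>S :: real ^ 'm ^ 'm. lam *\<^sub>R S - matrix_inv S"
  have F: "F S = ereal (reg_neg_log_det lam S)" if "S \<in> pd_mats" for S
    using assms(2)[OF that] by (simp add: reg_neg_log_det_def)
  have F_inf: "F S = \<infinity>" if "S \<in> sym_mats" "S \<notin> pd_mats" for S
    using assms(3) that by simp
  have dom: "edom F = pd_mats"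
    using F F_inf pd_mats_imp_sym by (fastforce simp: edom_def)
  have grad: "has_sym_gradient F (?G S) S" if S: "S \<in> pd_mats" for S
  proof -
    have sym: "?G S \<in> sym_mats"
      using bij_betw_apply[OF reg_gradient_bij[OF assms(1)] S] .
    have "((\<lambda>Y. real_of_ereal (F Y)) has_derivative (\<lambda>H. ?G S \<bullet> H)) (at S within pd_mats)"
      by (rule has_derivative_transform[OF S _ reg_neg_log_det_has_derivative[OF S]]) (simp add: F)
    then show ?thesis
      using S sym unfolding has_sym_gradient_def at_within_sym_mats[OF S] dom sym_interior_pd_mats
      by (simp add: inner_sym_mats)
  qed
  then have grad_eq: "sym_gradient F S = ?G S" if "S \<in> pd_mats" for S
    using that by (intro sym_gradient_eq)
  have strict: "strictly_convex_on pd_mats F"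
    using reg_neg_log_det_strict_convex[OF assms(1)]
    unfolding strictly_convex_on_def by (auto simp: F convex_pd_mats)
  have convex: "sym_convex F"
    unfolding sym_convex_def
  proof (intro ballI allI impI)
    fix X Y :: "real ^ 'm ^ 'm" and t :: real
    assume XY: "X \<in> sym_mats" "Y \<in> sym_mats" and t: "0 < t \<and> t < 1"
    have ninf: "F S \<noteq> -\<infinity>" if "S \<in> sym_mats" for S
      using F[of S] F_inf[OF that] by (cases "S \<in> pd_mats") auto
    show "F (t *\<^sub>R X + (1 - t) *\<^sub>R Y) \<le> ereal t * F X + ereal (1 - t) * F Y"
    proof (cases "X \<in> pd_mats \<and> Y \<in> pd_mats")
      case pd: True
      show ?thesis
      proof (cases "X = Y")
        case True
        then show ?thesis
          using pd by (simp add: F scaleR_left_distrib[symmetric] distrib_right[symmetric])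
      next
        case False
        then show ?thesis
          using pd t strict by (simp add: strictly_convex_on_def less_imp_le)
      qed
    next
      case False
      then have "ereal t * F X + ereal (1 - t) * F Y = \<infinity>"
        using F_inf XY t ninf[OF XY(1)] ninf[OF XY(2)]
        by (cases "F X"; cases "F Y") auto
      then show ?thesis by (simp only: ereal_less_eq)
    qed
  qed
  have lsc: "sym_lsc F"
    unfolding sym_lsc_def le_Liminf_iff
  proof (intro ballI allI impI)
    fix X :: "real ^ 'm ^ 'm" and y :: ereal
    assume X: "X \<in> sym_mats" and y: "y < F X"
    show "\<forall>\<^sub>F Y in at X within sym_mats. y < F Y"
    proof (cases "X \<in> pd_mats")
      case True
      have "(reg_neg_log_det lam \<longlongrightarrow> reg_neg_log_det lam X) (at X within pd_mats)"
        using has_derivative_continuous[OF reg_neg_log_det_has_derivative[OF True]]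
        by (simp add: continuous_within)
      then have "((\<lambda>S. ereal (reg_neg_log_det lam S)) \<longlongrightarrow> F X) (at X within pd_mats)"
        by (simp add: F True)
      then have "\<forall>\<^sub>F Y in at X within pd_mats. y < ereal (reg_neg_log_det lam Y)"
        using y by (rule order_tendstoD)
      then show ?thesis
        unfolding at_within_sym_mats[OF True] eventually_at_filter
        by eventually_elim (simp add: F)
    next
      case False
      then have "y < \<infinity>"
        using y by (cases y) auto
      then obtain K where K: "y \<le> ereal K"
        by (cases y) auto
      have "\<forall>\<^sub>F Y in at X. Y \<in> pd_mats \<longrightarrow> K < reg_neg_log_det lam Y"
        using assms(1) False by (intro reg_neg_log_det_eventually_large) auto
      then show ?thesis
        unfolding eventually_at_filter
      proof eventually_elim
        case (elim Y)
        then show ?case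
          using K \<open>y < \<infinity>\<close> F[of Y] F_inf[of Y]
          by (cases "Y \<in> pd_mats") (auto intro: le_less_trans)
      qed
    qed
  qed
  have "diag_mat (\<lambda>i. 1) \<in> (pd_mats :: (real ^ 'm ^ 'm) set)"
    by (rule pd_mats_diag) simp
  then have proper: "\<exists>X\<in>sym_mats. F X \<noteq> \<infinity>"
    using F pd_mats_imp_sym by (intro bexI[of _ "diag_mat (\<lambda>i. 1)"]) auto
  have "continuous_on pd_mats ?G"
    by (intro continuous_intros continuous_on_pd_matrix_inv)
  then have cont: "continuous_on pd_mats (sym_gradient F)"
    by (simp add: grad_eq cong: continuous_on_cong)
  have diff: "\<forall>X\<in>pd_mats. sym_differentiable F X"
    using grad by (auto simp: sym_differentiable_def)
  have "\<forall>X\<in>sym_mats. F X \<noteq> -\<infinity>"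
    using F F_inf by (metis MInfty_neq_PInfty(1) MInfty_neq_ereal(1))
  then have "F \<in> class_E"
    using convex proper lsc strict diff cont pd_mats_subset_psd_mats
    by (simp add: class_E_def dom)
  moreover have "essentially_smooth F"
    unfolding essentially_smooth_def dom sym_interior_pd_mats
    using diff norm_reg_gradient_at_top[of _ _ lam] sym_frontier_pd_mats
    by (auto simp: grad_eq)
  moreover have "bij_betw (sym_gradient F) pd_mats sym_mats"
    using reg_gradient_bij[OF assms(1)] by (simp add: grad_eq cong: bij_betw_cong)
  ultimately show ?thesis
    using grad grad_eq by blast
qed

end
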